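(* For every integer $k\ge 1$ let $G^k$, $p^k_b$ and $p^k_e$ be as defined in the context. Then the reconfiguration distance between $p^k_b$ and $p^k_e$ in the reconfiguration graph of shortest $(s,t)$-paths of $G^k$ is $\Theta(2^k)$; that is, there are constants $c_1,c_2>0$ such that for all $k\ge 1$ this distance lies between $c_1 2^k$ and $c_2 2^k$.
   Context: Reconfiguration graph of shortest $(s,t)$-paths of a graph: its vertices are the shortest $(s,t)$-paths (viewed as vertex sequences), and two of them are adjacent iff, as sequences, they differ in exactly one position. The reconfiguration distance between two shortest paths is their distance in this graph. The undirected graph $G^1$ has vertices $x^1_1,\dots,x^1_7$, $y^1_1,\dots,y^1_6$, $s$, $t$ and edges $x^1_iy^1_i$, $x^1_{i+1}y^1_i$, $y^1_it$ for $1\le i\le 6$, and $sx^1_i$ for $1\le i\le 7$. For $k\ge 2$, $G^k$ has vertex set $V(G^{k-1})\cup\{x^k_1,\dots,x^k_7,y^k_1,\dots,y^k_6\}$ and edge set consisting of: $x^k_iy^k_i$ and $x^k_{i+1}y^k_i$ for $1\le i\le 6$; $y^k_ix^{k-1}_j$ for $i\in\{1,3,5\}$ and $1\le j\le 7$; $y^k_2x^{k-1}_1$, $y^k_4x^{k-1}_7$, $y^k_6x^{k-1}_1$; all edges of $G^{k-1}$ not incident to $s$; and $sx^k_i$ for $1\le i\le 7$. Let $p^k_b=s,x^k_1,y^k_1,x^{k-1}_1,y^{k-1}_1,\dots,x^1_1,y^1_1,t$ and $p^k_e=s,x^k_7,y^k_6,x^{k-1}_1,y^{k-1}_1,\dots,x^1_1,y^1_1,t$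 (both are shortest $(s,t)$-paths in $G^k$). *)

theory Defs
  imports "Graph_Theory.Graph_Theory"
begin

text \<open>
  Undirected graphs are represented as symmetric pair digraphs, and paths as vertex sequences.
\<close>

definition shortest_vpath :: "('a, 'b) pre_digraph \<Rightarrow> 'a \<Rightarrow> 'a \<Rightarrow> 'a list \<Rightarrow> bool" where
  "shortest_vpath G s t p \<longleftrightarrow>
     vpath p G \<and> hd p = s \<and> last p = t \<and>
     (\<forall>q. vpath q G \<and> hd q = s \<and> last q = t \<longrightarrow> vwalk_length p \<le> vwalk_length q)"

definition differ_in_one :: "'a list \<Rightarrow> 'a list \<Rightarrow> bool" where
  "differ_in_one p q \<longleftrightarrow> length p = length q \<and> (\<exists>!i. i < length p \<and> p ! i \<noteq> q ! i)"

definition reconf_graph :: "('a, 'b) pre_digraph \<Rightarrow> 'a \<Rightarrow> 'a \<Rightarrow> 'a list pair_pre_digraph" where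
  "reconf_graph G s t =
     \<lparr> pverts = {p. shortest_vpath G s t p},
       parcs = {(p, q). shortest_vpath G s t p \<and> shortest_vpath G s t q \<and> differ_in_one p q} \<rparr>"

lemma wf_digraph_reconf_graph: "wf_digraph (with_proj (reconf_graph G s t))"
  by unfold_locales (auto simp: reconf_graph_def)

text \<open>
  With unit arc costs the library's shortest-walk cost is the usual graph distance
  (\<open>\<infinity>\<close> if there is no walk).
\<close>

definition reconf_dist ::
    "('a, 'b) pre_digraph \<Rightarrow> 'a \<Rightarrow> 'a \<Rightarrow> 'a list \<Rightarrow> 'a list \<Rightarrow> ereal" where
  "reconf_dist G s t p q = wf_digraph.\<mu> (with_proj (reconf_graph G s t)) (\<lambda>_. 1) p q"

text \<open>\<open>X k i\<close> stands for $x^k_i$ and \<open>Y k i\<close> for $y^k_i$.\<close>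

datatype vertex = Src | Tgt | X nat nat | Y nat nat

definition level_verts :: "nat \<Rightarrow> vertex set" where
  "level_verts k = X k ` {1..7} \<union> Y k ` {1..6}"

definition level_edges :: "nat \<Rightarrow> (vertex \<times> vertex) set" where
  "level_edges k =
     {(X k i, Y k i) | i. i \<in> {1..6}} \<union> {(X k (i + 1), Y k i) | i. i \<in> {1..6}} \<union>
     {(Src, X k i) | i. i \<in> {1..7}}"

text \<open>Edges between the vertices of level \<open>k\<close> and those of level \<open>k - 1\<close>, for \<open>k \<ge> 2\<close>.\<close>

definition link_edges :: "nat \<Rightarrow> (vertex \<times> vertex) set" where
  "link_edges k =
     {(Y k i, X (k - 1) j) | i j. i \<in> {1, 3, 5} \<and> j \<in> {1..7}} \<union>
     {(Y k 2, X (k - 1) 1), (Y k 4, X (k - 1) 7), (Y k 6, X (k - 1) 1)}"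

text \<open>The family starts at \<open>k = 1\<close>; the value at \<open>0\<close> is a dummy.\<close>

fun Gk :: "nat \<Rightarrow> vertex pair_pre_digraph" where
  "Gk 0 = \<lparr> pverts = {}, parcs = {} \<rparr>"
| "Gk (Suc 0) =
     \<lparr> pverts = level_verts 1 \<union> {Src, Tgt},
       parcs = symcl (level_edges 1 \<union> {(Y 1 i, Tgt) | i. i \<in> {1..6}}) \<rparr>"
| "Gk (Suc (Suc n)) =
     (let k = Suc (Suc n); H = Gk (Suc n) in
     \<lparr> pverts = pverts H \<union> level_verts k,
       parcs = symcl (level_edges k \<union> link_edges k) \<union>
               {(u, v) \<in> parcs H. u \<noteq> Src \<and> v \<noteq> Src} \<rparr>)"

text \<open>\<open>base_path k\<close> is the sequence $x^k_1, y^k_1, \ldots, x^1_1, y^1_1, t$.\<close>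

primrec base_path :: "nat \<Rightarrow> vertex list" where
  "base_path 0 = [Tgt]"
| "base_path (Suc k) = X (Suc k) 1 # Y (Suc k) 1 # base_path k"

definition p_b :: "nat \<Rightarrow> vertex list" where
  "p_b k = Src # base_path k"

definition p_e :: "nat \<Rightarrow> vertex list" where
  "p_e k = Src # X k 7 # Y k 6 # base_path (k - 1)"

end

theory Submission
  imports Defs
begin

text \<open>
  Every shortest path descends through the levels, so at level \<open>j\<close> it uses an edge of the path
  $x^j_1, y^j_1, x^j_2, \ldots, y^j_6, x^j_7$, and a reconfiguration step moves this edge to a
  neighbouring one on at most one level. The links at $y^j_2$, $y^j_4$, $y^j_6$ force the vertex
  $x^{j-1}$ to be at $x^{j-1}_1$, $x^{j-1}_7$, $x^{j-1}_1$ respectively. Hence traversing level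
  \<open>j\<close> from one end to the other requires traversing level \<open>j - 1\<close> back and forth in two disjoint
  time intervals, which doubles the number of steps. Conversely, two traversals of level
  \<open>j - 1\<close>, made while level \<open>j\<close> waits at $y^j_3$ and $y^j_5$, and 11 steps on level \<open>j\<close> suffice,
  which gives \<open>11 * (2 ^ k - 1)\<close> steps in total.
\<close>

subsection \<open>Reconfiguration sequences and their lengths\<close>

lemma differ_in_one_Nil [simp]: "\<not> differ_in_one [] q" "\<not> differ_in_one p []"
  by (auto simp: differ_in_one_def)

lemma Ex1_nat_iff:
  "(\<exists>!i::nat. P i) \<longleftrightarrow> (if P 0 then \<forall>i. \<not> P (Suc i) else \<exists>!i. P (Suc i))"
  by (metis nat.exhaust nat.inject old.nat.distinct(2))

text \<open>Makes \<open>differ_in_one\<close> recursive: once the heads differ, the single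
  permitted difference is spent. This suits paths that are built level by level.\<close>

lemma differ_in_one_Cons [simp]:
  "differ_in_one (a # p) (b # q) \<longleftrightarrow> (if a = b then differ_in_one p q else p = q)"
  unfolding differ_in_one_def by (subst Ex1_nat_iff) (auto simp: list_eq_iff_nth_eq)

lemma differ_in_one_sym: "differ_in_one p q \<Longrightarrow> differ_in_one q p"
  by (auto simp: differ_in_one_def eq_commute)

section \<open>Relation powers as a count of steps along walks\<close>

lemma relpow_map:
  assumes "(x, y) \<in> R ^^ n" and "\<And>a b. (a, b) \<in> R \<Longrightarrow> (f a, f b) \<in> S"
  shows "(f x, f y) \<in> S ^^ n"
  using assms(1) by (induction n arbitrary: y) (auto intro: relcompI assms(2))

lemma relpow_converse:
  fixes R :: "('a \<times> 'a) set"
  shows "(x, y) \<in> R ^^ n \<Longrightarrow> (y, x) \<in> (R\<inverse>) ^^ n"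
proof (induction n arbitrary: y)
  case (Suc n)
  then obtain z where "(x, z) \<in> R ^^ n" "(z, y) \<in> R" by auto
  with Suc.IH show ?case by (intro relpow_Suc_I2[of y z]) auto
qed auto

lemma relpow_trans:
  assumes "(x, y) \<in> R ^^ m" "(y, z) \<in> R ^^ n"
  shows "(x, z) \<in> R ^^ (m + n)"
  using assms by (auto simp: relpow_add)

lemma awalk_imp_relpow:
  assumes "wf_digraph (with_proj H)" "pre_digraph.awalk (with_proj H) u p v"
  shows "(u, v) \<in> parcs H ^^ length p"
proof -
  interpret wf_digraph "with_proj H" by fact
  from assms(2) show ?thesis
    by (induction p arbitrary: u)
      (auto simp: awalk_simps simp del: relpow.simps(2) intro: relpow_Suc_I2)
qed

text \<open>The hypothesis on \<open>v\<close> serves the case \<open>n = 0\<close>, where the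
  relation power does not show that \<open>v\<close> is a vertex.\<close>

lemma relpow_imp_awalk:
  assumes "wf_digraph (with_proj H)" "(u, v) \<in> parcs H ^^ n" "v \<in> pverts H"
  shows "\<exists>p. pre_digraph.awalk (with_proj H) u p v \<and> length p = n"
proof -
  interpret wf_digraph "with_proj H" by fact
  from assms(2) show ?thesis
  proof (induction n arbitrary: u)
    case 0
    with assms(3) show ?case by (auto simp: awalk_simps)
  next
    case (Suc n)
    then obtain w where w: "(u, w) \<in> parcs H" "(w, v) \<in> parcs H ^^ n"
      by (metis relpow_Suc_D2)
    with Suc.IH obtain p where p: "awalk w p v" "length p = n" by blast
    moreover have "u \<in> pverts H" using w(1) tail_in_verts by fastforce
    ultimately have "awalk u ((u, w) # p) v" using w(1) by (auto simp: awalk_simps)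
    with p(2) show ?case by (metis length_Cons)
  qed
qed

text \<open>With unit costs the cost of a walk is its number of arcs, so a bound valid for every
  walk passes to the infimum, also when no walk exists and the infimum is infinite.\<close>

lemma reconf_dist_ge:
  assumes "\<And>n. (p, q) \<in> parcs (reconf_graph G s t) ^^ n \<Longrightarrow> c \<le> real n"
  shows "ereal c \<le> reconf_dist G s t p q"
proof -
  interpret wf_digraph "with_proj (reconf_graph G s t)" by (rule wf_digraph_reconf_graph)
  show ?thesis
    unfolding reconf_dist_def \<mu>_def
    using assms[OF awalk_imp_relpow[OF wf_digraph_reconf_graph]]
    by (auto intro!: INF_greatest simp: awalk_cost_def sum_list_triv)
qed

lemma reconf_dist_le:
  assumes "(p, q) \<in> parcs (reconf_graph G s t) ^^ n" "shortest_vpath G s t q"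
  shows "reconf_dist G s t p q \<le> ereal (real n)"
proof -
  interpret wf_digraph "with_proj (reconf_graph G s t)" by (rule wf_digraph_reconf_graph)
  have "q \<in> pverts (reconf_graph G s t)"
    using assms(2) by (simp add: reconf_graph_def)
  then obtain w where "awalk p w q" "length w = n"
    using relpow_imp_awalk[OF wf_digraph_reconf_graph assms(1)] by blast
  then show ?thesis
    using min_cost_le_walk_cost[of p w q "\<lambda>_. 1"]
    by (simp add: reconf_dist_def awalk_cost_def sum_list_triv)
qed

subsection \<open>Shortest paths descend through the levels\<close>

text \<open>The edges of \<open>Gk k\<close>, directed towards \<open>Tgt\<close>.\<close>

fun down :: "nat \<Rightarrow> vertex \<Rightarrow> vertex \<Rightarrow> bool" where
  "down k Src v \<longleftrightarrow> (\<exists>i\<in>{1..7}. v = X k i)"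
| "down k (X l i) v \<longleftrightarrow> l \<in> {1..k} \<and> (\<exists>j\<in>{1..6}. v = Y l j \<and> i \<in> {j, j + 1})"
| "down k (Y l j) v \<longleftrightarrow> l \<in> {1..k} \<and> j \<in> {1..6} \<and>
     (if l = 1 then v = Tgt
      else \<exists>i\<in>{1..7}. v = X (l - 1) i \<and> (j \<in> {2, 6} \<longrightarrow> i = 1) \<and> (j = 4 \<longrightarrow> i = 7))"
| "down k Tgt v \<longleftrightarrow> False"

text \<open>On the vertices of \<open>Gk k\<close> with \<open>k \<ge> 1\<close> this is the
  distance to \<open>Tgt\<close>.\<close>

fun height :: "nat \<Rightarrow> vertex \<Rightarrow> nat" where
  "height k Src = 2 * k + 1"
| "height k (X l i) = 2 * l"
| "height k (Y l j) = 2 * l - 1"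
| "height k Tgt = 0"

lemma height_down: "down k u v \<Longrightarrow> height k u = Suc (height k v)"
  by (cases u) (auto split: if_splits)

lemma mem_symcl_iff: "(u, v) \<in> symcl R \<longleftrightarrow> (u, v) \<in> R \<or> (v, u) \<in> R"
  by (auto simp: symcl_def)

lemma atLeastAtMost_1_6: "{1..6} = {1, 2, 3, 4, 5, 6::nat}"
  by auto

lemma down_1:
  "down 1 u v \<longleftrightarrow> (u, v) \<in> level_edges 1 \<union> {(Y 1 i, Tgt) | i. i \<in> {1..6}}"
  by (cases u) (auto simp: level_edges_def)

text \<open>From one level to the next, the only old edges lost are those at \<open>Src\<close>. At
  \<open>n = 0\<close> this fails: the edges from level 1 to \<open>Tgt\<close> are not link
  edges.\<close>

lemma down_Suc:
  assumes "1 \<le> n"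
  shows "down (Suc n) u v \<longleftrightarrow>
    (u, v) \<in> level_edges (Suc n) \<union> link_edges (Suc n) \<or> down n u v \<and> u \<noteq> Src"
proof (cases u)
  case (Y l j)
  show ?thesis
    using assms unfolding Y level_edges_def link_edges_def atLeastAtMost_1_6
    by (cases "l = Suc n") auto
qed (use assms in \<open>auto simp: level_edges_def link_edges_def le_Suc_eq\<close>)

lemma down_not_Src: "\<not> down k u Src"
  by (cases u) auto

lemma parcs_Gk: "(u, v) \<in> parcs (Gk (Suc n)) \<longleftrightarrow> down (Suc n) u v \<or> down (Suc n) v u"
proof (induction n)
  case 0
  show ?case
    using down_1[of u v] down_1[of v u] by (simp add: mem_symcl_iff)
next
  case (Suc n)
  show ?case
    unfolding Gk.simps Let_def
    using Suc.IH down_Suc[of "Suc n" u v] down_Suc[of "Suc n" v u] down_not_Src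
    by (auto simp: mem_symcl_iff simp del: Gk.simps)
qed

lemma pverts_Gk: "pverts (Gk (Suc n)) = {Src, Tgt} \<union> (\<Union>l\<in>{1..Suc n}. level_verts l)"
proof (induction n)
  case (Suc n)
  have "{1..Suc (Suc n)} = insert (Suc (Suc n)) {1..Suc n}" by auto
  then show ?case using Suc.IH by (auto simp: Let_def simp del: atLeastAtMost_iff)
qed auto

text \<open>\<open>descent k\<close> describes the part of a shortest path from level \<open>k\<close> down to \<open>Tgt\<close>.\<close>

primrec descent :: "nat \<Rightarrow> vertex list \<Rightarrow> bool" where
  "descent 0 p \<longleftrightarrow> p = [Tgt]"
| "descent (Suc k) p \<longleftrightarrow> (\<exists>i j q. p = X (Suc k) i # Y (Suc k) j # q \<and> descent k q \<and>
     j \<in> {1..6} \<and> i \<in> {j, j + 1} \<and>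
     (0 < k \<longrightarrow> (j \<in> {2, 6} \<longrightarrow> hd q = X k 1) \<and> (j = 4 \<longrightarrow> hd q = X k 7)))"

lemma descent_not_Nil: "descent l p \<Longrightarrow> p \<noteq> []"
  by (cases l) auto

lemma hd_descent: "descent (Suc l) p \<Longrightarrow> \<exists>i\<in>{1..7}. hd p = X (Suc l) i"
  by auto

lemma length_descent: "descent l p \<Longrightarrow> length p = 2 * l + 1"
  by (induction l arbitrary: p) auto

lemma last_descent: "descent l p \<Longrightarrow> last p = Tgt"
  by (induction l arbitrary: p) (auto dest: descent_not_Nil)

lemma set_descent: "descent l p \<Longrightarrow> set p \<subseteq> {Tgt} \<union> (\<Union>l'\<in>{1..l}. level_verts l')"
proof (induction l arbitrary: p)
  case (Suc l)
  then obtain i j q where p: "p = X (Suc l) i # Y (Suc l) j # q" "descent l q"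
    "j \<in> {1..6}" "i \<in> {j, j + 1}"
    by auto
  then have "X (Suc l) i \<in> level_verts (Suc l)" "Y (Suc l) j \<in> level_verts (Suc l)"
    by (auto simp: level_verts_def)
  with p(1) Suc.IH[OF p(2)] show ?case by fastforce
qed auto

lemma distinct_descent: "descent l p \<Longrightarrow> distinct p"
proof (induction l arbitrary: p)
  case (Suc l)
  then obtain i j q where p: "p = X (Suc l) i # Y (Suc l) j # q" "descent l q"
    by auto
  with set_descent[OF p(2)] Suc.IH[OF p(2)] show ?case
    by (auto simp: level_verts_def)
qed auto

lemma arcs_descent:
  assumes "descent l p" "l \<le> k" "(u, v) \<in> set (vwalk_arcs p)"
  shows "down k u v"
  using assms
proof (induction l arbitrary: p)
  case (Suc l)
  then obtain i j q where p: "p = X (Suc l) i # Y (Suc l) j # q" "descent l q"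
    "j \<in> {1..6}" "i \<in> {j, j + 1}"
    "0 < l \<Longrightarrow> (j \<in> {2, 6} \<longrightarrow> hd q = X l 1) \<and> (j = 4 \<longrightarrow> hd q = X l 7)"
    by auto
  consider "(u, v) = (X (Suc l) i, Y (Suc l) j)" | "(u, v) = (Y (Suc l) j, hd q)"
    | "(u, v) \<in> set (vwalk_arcs q)"
    using Suc.prems(3) p(1) descent_not_Nil[OF p(2)] by auto
  then show ?case
  proof cases
    case 2
    show ?thesis
    proof (cases l)
      case 0
      with 2 p(2,3) Suc.prems(2) show ?thesis by auto
    next
      case (Suc l')
      with hd_descent p(2) obtain i' where "i' \<in> {1..7}" "hd q = X l i'" by blast
      with 2 p(3,5) Suc Suc.prems(2) show ?thesis by auto
    qed
  next
    case 3
    with Suc.IH[OF p(2)] Suc.prems(2) show ?thesis by simp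
  qed (use p Suc.prems(2) in auto)
qed auto

text \<open>Each arc changes the height by exactly one and \<open>Tgt\<close> has height 0, so a
  walk to \<open>Tgt\<close> needs at least as many arcs as the height of its start.\<close>

lemma height_less_length:
  assumes "vwalk p (with_proj (Gk (Suc n)))" "last p = Tgt"
  shows "height (Suc n) (hd p) < length p"
  using assms
proof (induction rule: vwalk_induct)
  case (Cons u v es)
  then have "down (Suc n) u v \<or> down (Suc n) v u" by (simp add: parcs_Gk del: Gk.simps)
  with Cons show ?case by (auto dest: height_down)
qed auto

text \<open>If the number of arcs equals the height there is no slack: a first arc going up would
  leave too few arcs for the rest. The remaining walk is tight again, so the argument
  iterates.\<close>

lemma vwalk_tight_down:
  assumes "vwalk (u # v # p) (with_proj (Gk (Suc n)))" "last (v # p) = Tgt"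
    and "length (u # v # p) = Suc (height (Suc n) u)"
  shows "down (Suc n) u v" "vwalk (v # p) (with_proj (Gk (Suc n)))"
    "length (v # p) = Suc (height (Suc n) v)"
proof -
  from assms(1) have uv: "down (Suc n) u v \<or> down (Suc n) v u"
    and w: "vwalk (v # p) (with_proj (Gk (Suc n)))"
    by (auto simp: vwalk_def parcs_Gk simp del: Gk.simps)
  with height_less_length[OF w assms(2)] assms(3) show "down (Suc n) u v"
    by (auto dest: height_down)
  from height_down[OF this] assms(3) show "length (v # p) = Suc (height (Suc n) v)"
    by simp
qed (use assms in \<open>auto simp: vwalk_def\<close>)

lemma vwalk_tight_descent:
  assumes "vwalk p (with_proj (Gk (Suc n)))" "last p = Tgt"
    and "length p = 2 * l + 1" "height (Suc n) (hd p) = 2 * l"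
  shows "descent l p"
  using assms
proof (induction l arbitrary: p)
  case 0
  then show ?case by (cases p) auto
next
  case (Suc l)
  then have "length p = Suc (Suc (Suc (2 * l)))" by simp
  then obtain u v w q where p: "p = u # v # w # q"
    by (auto simp: length_Suc_conv simp del: mult_2)
  have 1: "down (Suc n) u v" "vwalk (v # w # q) (with_proj (Gk (Suc n)))"
    "length (v # w # q) = Suc (height (Suc n) v)"
    using vwalk_tight_down[of u v "w # q" n] Suc.prems p by auto
  have 2: "down (Suc n) v w" "vwalk (w # q) (with_proj (Gk (Suc n)))"
    "length (w # q) = Suc (height (Suc n) w)"
    using vwalk_tight_down[of v w q n] 1 Suc.prems p by auto
  have "descent l (w # q)"
    using Suc.IH[of "w # q"] 2 Suc.prems p by auto
  \<comment> \<open>Parity decides: \<open>u\<close> has even height, while \<open>Src\<close> and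
    the \<open>Y\<close> vertices on levels from 1 on have odd height.\<close>
  moreover obtain i where "u = X (Suc l) i"
  proof (cases u)
    case (Y l' j)
    with Suc.prems(4) p 1(1) have "2 * l' - 1 = 2 * Suc l" "1 \<le> l'" by auto
    then have False by presburger
    then show ?thesis ..
  next
    case Src
    with Suc.prems(4) p have "2 * Suc n + 1 = 2 * Suc l" by simp
    then have False by presburger
    then show ?thesis ..
  qed (use Suc.prems(4) p that in auto)
  moreover from this 1(1) obtain j where "v = Y (Suc l) j" "j \<in> {1..6}" "i \<in> {j, j + 1}"
    by auto
  ultimately show ?case
    using 2(1) p by (auto split: if_splits)
qed

lemma vwalk_Src_Cons_descent:
  assumes "descent (Suc n) q"
  shows "vwalk (Src # q) (with_proj (Gk (Suc n)))"
proof (rule vwalkI)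
  have "down (Suc n) Src (hd q)" using hd_descent[OF assms] by auto
  then show "set (vwalk_arcs (Src # q)) \<subseteq> arcs_ends (with_proj (Gk (Suc n)))"
    using arcs_descent[OF assms] descent_not_Nil[OF assms]
    by (auto simp: parcs_Gk simp del: Gk.simps)
  show "set (Src # q) \<subseteq> verts (with_proj (Gk (Suc n)))"
    using set_descent[OF assms] by (auto simp: pverts_Gk simp del: Gk.simps)
qed simp

lemma vpath_Src_Cons_descent:
  assumes "descent (Suc n) q"
  shows "vpath (Src # q) (with_proj (Gk (Suc n)))"
  using vwalk_Src_Cons_descent[OF assms] distinct_descent[OF assms] set_descent[OF assms]
  by (auto simp: vpath_def level_verts_def simp del: Gk.simps)

lemma descent_base_path: "descent k (base_path k)"
  by (induction k) (auto simp: gr0_conv_Suc)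

text \<open>The base path shows that the height bound is attained, so every shortest path is tight
  and hence descends. Conversely, all descents of one level have the same length, which meets the
  bound.\<close>

lemma shortest_vpath_Gk_iff:
  "shortest_vpath (with_proj (Gk (Suc n))) Src Tgt p \<longleftrightarrow> (\<exists>q. p = Src # q \<and> descent (Suc n) q)"
  (is "?L \<longleftrightarrow> ?R")
proof
  assume L: ?L
  then have p: "vwalk p (with_proj (Gk (Suc n)))" "hd p = Src" "last p = Tgt"
    by (auto simp: shortest_vpath_def vpath_def)
  have "length p - 1 \<le> length (base_path (Suc n))"
    using L vpath_Src_Cons_descent[OF descent_base_path, of n]
      last_descent[OF descent_base_path] descent_not_Nil[OF descent_base_path]
    unfolding shortest_vpath_def
    by (auto dest!: conjunct2 spec[of _ "Src # base_path (Suc n)"] simp del: Gk.simps base_path.simps)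
  with height_less_length[OF p(1,3)] p(2) length_descent[OF descent_base_path]
  have len: "length p = 2 * Suc n + 2" by auto
  then have "length p = Suc (Suc (2 * Suc n))" by simp
  with p(2) obtain v q where vq: "p = Src # v # q"
    by (auto simp: length_Suc_conv)
  have "down (Suc n) Src v" "vwalk (v # q) (with_proj (Gk (Suc n)))"
    using vwalk_tight_down[of Src v q n] p len vq by auto
  then have "descent (Suc n) (v # q)"
    using p len vq by (intro vwalk_tight_descent[of _ n]) auto
  with vq show ?R by blast
next
  assume ?R
  then obtain q where q: "p = Src # q" "descent (Suc n) q" by blast
  show ?L
    unfolding shortest_vpath_def
  proof (intro conjI allI impI)
    fix r assume "vpath r (with_proj (Gk (Suc n))) \<and> hd r = Src \<and> last r = Tgt"
    with height_less_length[of r n] length_descent[OF q(2)] q(1)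
    show "vwalk_length p \<le> vwalk_length r"
      by (auto simp: vpath_def simp del: Gk.simps)
  qed (use q vpath_Src_Cons_descent[OF q(2)] last_descent[OF q(2)] descent_not_Nil[OF q(2)]
      in \<open>auto simp del: Gk.simps\<close>)
qed

section \<open>Reconfiguration steps on descents, with the common first vertex \<open>Src\<close>
  removed\<close>

definition moves :: "nat \<Rightarrow> (vertex list \<times> vertex list) set" where
  "moves k = {(p, q). descent k p \<and> descent k q \<and> differ_in_one p q}"

lemma parcs_reconf_graph_Gk:
  "parcs (reconf_graph (with_proj (Gk (Suc n))) Src Tgt) =
     (\<lambda>(p, q). (Src # p, Src # q)) ` moves (Suc n)"
  by (auto simp: reconf_graph_def shortest_vpath_Gk_iff moves_def image_iff
      simp del: Gk.simps descent.simps)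

lemma reconf_relpow_iff:
  "(Src # p, Src # q) \<in> parcs (reconf_graph (with_proj (Gk (Suc n))) Src Tgt) ^^ m \<longleftrightarrow>
     (p, q) \<in> moves (Suc n) ^^ m"
  (is "(_, _) \<in> ?A ^^ m \<longleftrightarrow> _")
proof
  assume "(Src # p, Src # q) \<in> ?A ^^ m"
  then have "(tl (Src # p), tl (Src # q)) \<in> moves (Suc n) ^^ m"
    by (rule relpow_map) (auto simp: parcs_reconf_graph_Gk simp del: Gk.simps)
  then show "(p, q) \<in> moves (Suc n) ^^ m" by simp
next
  assume "(p, q) \<in> moves (Suc n) ^^ m"
  then show "(Src # p, Src # q) \<in> ?A ^^ m"
    by (rule relpow_map) (force simp: parcs_reconf_graph_Gk simp del: Gk.simps)
qed

subsection \<open>Lower bound\<close>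

lemma intermediate_value_between:
  fixes f :: "nat \<Rightarrow> int"
  assumes "\<And>i. a \<le> i \<Longrightarrow> i < b \<Longrightarrow> \<bar>f (Suc i) - f i\<bar> \<le> 1" "a \<le> b"
    and "f a \<le> k \<and> k \<le> f b \<or> f b \<le> k \<and> k \<le> f a"
  shows "\<exists>i\<ge>a. i \<le> b \<and> f i = k"
  using assms(3)
proof
  assume "f a \<le> k \<and> k \<le> f b"
  with assms nat_intermed_int_val[of a b f k] show ?thesis by auto
next
  assume "f b \<le> k \<and> k \<le> f a"
  with assms nat_intermed_int_val[of a b "\<lambda>i. - f i" "- k"] show ?thesis
    by (fastforce simp: abs_minus_commute)
qed

fun vindex :: "vertex \<Rightarrow> nat" where
  "vindex (X l i) = i"
| "vindex (Y l j) = j"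
| "vindex _ = 0"

text \<open>A step keeps the \<open>X\<close> or the \<open>Y\<close> vertex of the top level, and
  two \<open>Y\<close> vertices next to the same \<open>X\<close> vertex have indices at most one
  apart. Entry 1 is the top \<open>Y\<close> vertex; \<open>drop 2\<close> leaves the lower
  levels.\<close>

lemma descent_step:
  assumes "descent (Suc k) p" "descent (Suc k) q" "p = q \<or> differ_in_one p q"
  shows "\<bar>int (vindex (q ! 1)) - int (vindex (p ! 1))\<bar> \<le> 1"
    and "drop 2 p = drop 2 q \<or> differ_in_one (drop 2 p) (drop 2 q)"
proof -
  from assms(1,2) obtain i j r i' j' r'
    where p: "p = X (Suc k) i # Y (Suc k) j # r" "i \<in> {j, j + 1}"
      and q: "q = X (Suc k) i' # Y (Suc k) j' # r'" "i' \<in> {j', j' + 1}"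
    unfolding descent.simps(2) by blast
  from assms(3) p(1) q(1) have "i = i' \<or> j = j'" and r: "r = r' \<or> differ_in_one r r'"
    by (auto split: if_splits)
  with p q show "\<bar>int (vindex (q ! 1)) - int (vindex (p ! 1))\<bar> \<le> 1" by auto
  from p q r show "drop 2 p = drop 2 q \<or> differ_in_one (drop 2 p) (drop 2 q)" by simp
qed

text \<open>The statement is shaped for induction on the level: pauses are allowed because a step on
  the top level leaves the lower levels fixed, the time interval is arbitrary because it gets split,
  and the ends are unordered because the lower level is also traversed backwards.\<close>

lemma traversal_length_ge:
  assumes "\<And>i. a \<le> i \<Longrightarrow> i \<le> b \<Longrightarrow> descent (Suc n) (q i)"
    and "\<And>i. a \<le> i \<Longrightarrow> i < b \<Longrightarrow> q i = q (Suc i) \<or> differ_in_one (q i) (q (Suc i))"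
    and "a \<le> b"
    and "{hd (q a), hd (q b)} = {X (Suc n) 1, X (Suc n) 7}"
  shows "2 ^ n \<le> b - a"
  using assms
proof (induction n arbitrary: a b q)
  case 0
  then have "hd (q a) \<noteq> hd (q b)" by (auto simp: doubleton_eq_iff)
  then have "a \<noteq> b" by auto
  with 0 show ?case by simp
next
  case (Suc n)
  define y where "y i = vindex (q i ! 1)" for i
  define r where "r i = drop 2 (q i)" for i
  have q: "y i \<in> {1..6} \<and> descent (Suc n) (r i) \<and>
      (y i \<in> {2, 6} \<longrightarrow> hd (r i) = X (Suc n) 1) \<and> (y i = 4 \<longrightarrow> hd (r i) = X (Suc n) 7) \<and>
      vindex (hd (q i)) \<in> {y i, y i + 1}"
    if "a \<le> i" "i \<le> b" for i
    using Suc.prems(1)[OF that] unfolding y_def r_def descent.simps(2)[of "Suc n"]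
    by (elim exE conjE) (simp del: descent.simps)
  have y: "\<bar>int (y (Suc i)) - int (y i)\<bar> \<le> 1" if "a \<le> i" "i < b" for i
    using descent_step(1)[OF Suc.prems(1)[of i] Suc.prems(1)[of "Suc i"] Suc.prems(2)[of i]] that
    by (simp add: y_def del: descent.simps)
  have r: "r i = r (Suc i) \<or> differ_in_one (r i) (r (Suc i))" if "a \<le> i" "i < b" for i
    using descent_step(2)[OF Suc.prems(1)[of i] Suc.prems(1)[of "Suc i"] Suc.prems(2)[of i]] that
    by (simp add: r_def del: descent.simps)
  have ivt: "\<exists>i\<ge>a'. i \<le> b' \<and> y i = k"
    if "a \<le> a'" "a' \<le> b'" "b' \<le> b" "y a' \<le> k \<and> k \<le> y b' \<or> y b' \<le> k \<and> k \<le> y a'"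
    for a' b' k
    using intermediate_value_between[of a' b' "\<lambda>i. int (y i)" "int k"] y that by auto
  have "vindex (hd (q a)) = 1 \<and> vindex (hd (q b)) = 7 \<or>
      vindex (hd (q a)) = 7 \<and> vindex (hd (q b)) = 1"
    using Suc.prems(4) by (auto simp: doubleton_eq_iff)
  moreover have "y a \<in> {1..6}" "vindex (hd (q a)) \<in> {y a, y a + 1}"
    "y b \<in> {1..6}" "vindex (hd (q b)) \<in> {y b, y b + 1}"
    using q Suc.prems(3) by blast+
  \<comment> \<open>Within a level, the first \<open>X\<close> vertex meets only the first
    \<open>Y\<close> vertex and the seventh only the sixth.\<close>
  ultimately have ends: "y a = 1 \<and> y b = 6 \<or> y a = 6 \<and> y b = 1"
    by auto
  with ivt[of a b 4] Suc.prems(3) obtain m where m: "a \<le> m" "m \<le> b" "y m = 4" by auto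
  \<comment> \<open>On either side of \<open>m\<close> some time forces the lower level to its first
    \<open>X\<close> vertex: an end with \<open>y = 6\<close> serves itself, and between an end with
    \<open>y = 1\<close> and \<open>m\<close> the index passes 2.\<close>
  obtain l where l: "a \<le> l" "l \<le> m" "y l \<in> {2, 6}"
    using ends
  proof
    assume "y a = 1 \<and> y b = 6"
    with ivt[of a m 2] m that show ?thesis by auto
  qed (use m that[of a] in auto)
  obtain u where u: "m \<le> u" "u \<le> b" "y u \<in> {2, 6}"
    using ends
  proof
    assume "y a = 6 \<and> y b = 1"
    with ivt[of m b 2] m that show ?thesis by auto
  qed (use m that[of b] in auto)
  \<comment> \<open>The lower level is at index 1 at \<open>l\<close> and \<open>u\<close> and at
    index 7 at \<open>m\<close>; the intervals share only the time \<open>m\<close>, so the two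
    bounds add up.\<close>
  have "2 ^ n \<le> m - l"
    using q r l m by (intro Suc.IH[of l m r]) (auto simp del: descent.simps)
  moreover have "2 ^ n \<le> u - m"
    using q r u m by (intro Suc.IH[of m u r]) (auto simp del: descent.simps)
  ultimately show ?case using l u by simp
qed

lemma moves_relpow_ge:
  assumes "(p, q) \<in> moves (Suc n) ^^ m"
    and "hd p = X (Suc n) 1" "hd q = X (Suc n) 7"
  shows "2 ^ n \<le> m"
proof -
  from assms(1) obtain f where f: "f 0 = p" "f m = q"
    and step: "\<And>i. i < m \<Longrightarrow> (f i, f (Suc i)) \<in> moves (Suc n)"
    by (auto simp: relpow_fun_conv)
  \<comment> \<open>Being a descent is read off from steps: the outgoing one for
    \<open>i < m\<close>, the incoming one for \<open>i = m\<close>, which exists as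
    \<open>m\<close> is nonzero.\<close>
  have "m \<noteq> 0" using f assms(2,3) by (cases m) auto
  have "descent (Suc n) (f i)" if "i \<le> m" for i
    using step[of i] step[of "i - 1"] that \<open>m \<noteq> 0\<close>
    by (cases "i < m") (auto simp: moves_def simp del: descent.simps)
  then have "2 ^ n \<le> m - 0"
    using step f assms(2,3)
    by (intro traversal_length_ge[of 0 m n f]) (auto simp: moves_def simp del: descent.simps)
  then show ?thesis by simp
qed

subsection \<open>Upper bound\<close>

text \<open>For positive levels this is \<open>p_e\<close> without \<open>Src\<close>. At 0 it
  agrees with \<open>base_path\<close>, so the recursion for the upper bound starts with zero
  steps.\<close>

primrec end_path :: "nat \<Rightarrow> vertex list" where
  "end_path 0 = [Tgt]"
| "end_path (Suc k) = X (Suc k) 7 # Y (Suc k) 6 # base_path k"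

lemma descent_end_path: "descent k (end_path k)"
  using descent_base_path by (cases k) (auto simp: gr0_conv_Suc)

lemma hd_base_path: "0 < k \<Longrightarrow> hd (base_path k) = X k 1"
  by (cases k) auto

lemma hd_end_path: "0 < k \<Longrightarrow> hd (end_path k) = X k 7"
  by (cases k) auto

lemma moves_sym: "(p, q) \<in> moves k \<Longrightarrow> (q, p) \<in> moves k"
  by (auto simp: moves_def differ_in_one_sym)

lemma moves_relpow_sym:
  assumes "(p, q) \<in> moves k ^^ n"
  shows "(q, p) \<in> moves k ^^ n"
proof -
  have "(moves k)\<inverse> = moves k" by (auto intro: moves_sym)
  with relpow_converse[OF assms] show ?thesis by simp
qed

text \<open>The odd-indexed \<open>Y\<close> vertices are joined to every \<open>X\<close> vertex
  one level below, so the lower levels can move freely while the top level waits there.\<close>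

lemma moves_lift:
  assumes "(p, q) \<in> moves k ^^ n" "j \<in> {1, 3, 5}" "i \<in> {j, j + 1}"
  shows "(X (Suc k) i # Y (Suc k) j # p, X (Suc k) i # Y (Suc k) j # q) \<in> moves (Suc k) ^^ n"
  using assms(1)
  by (rule relpow_map) (use assms(2,3) in \<open>auto simp: moves_def\<close>)

text \<open>The step count solves the recursion \<open>L (Suc k) = 2 * L k + 11\<close> with
  \<open>L 0 = 0\<close>.\<close>

lemma moves_base_end: "(base_path k, end_path k) \<in> moves k ^^ (11 * (2 ^ k - 1))"
proof (induction k)
  case (Suc k)
  define N where "N = 11 * (2 ^ k - 1 :: nat)"
  let ?s = "\<lambda>i j q. X (Suc k) i # Y (Suc k) j # q"
  let ?B = "base_path k" and ?E = "end_path k"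
  note [simp] = moves_def descent_base_path descent_end_path hd_base_path hd_end_path
  have BE: "(?B, ?E) \<in> moves k ^^ N" using Suc.IH by (simp add: N_def del: moves_def)
  have step: "(p, q) \<in> moves (Suc k) ^^ 1" if "(p, q) \<in> moves (Suc k)" for p q
    using that by (simp del: moves_def)
  \<comment> \<open>The top level advances in three blocks, split by the tail required:
    \<open>?B\<close> to pass index 2, \<open>?E\<close> to pass index 4, and \<open>?B\<close>
    again to reach index 6. They take 4 + 4 + 3 = 11 steps.\<close>
  have up1: "(?s 1 1 ?B, ?s 3 3 ?B) \<in> moves (Suc k) ^^ (1 + 1 + 1 + 1)"
    by (rule relpow_trans[where y = "?s 3 2 ?B"], rule relpow_trans[where y = "?s 2 2 ?B"],
        rule relpow_trans[where y = "?s 2 1 ?B"]; rule step; simp)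
  have up2: "(?s 3 3 ?E, ?s 5 5 ?E) \<in> moves (Suc k) ^^ (1 + 1 + 1 + 1)"
    by (rule relpow_trans[where y = "?s 5 4 ?E"], rule relpow_trans[where y = "?s 4 4 ?E"],
        rule relpow_trans[where y = "?s 4 3 ?E"]; rule step; simp)
  have up3: "(?s 5 5 ?B, ?s 7 6 ?B) \<in> moves (Suc k) ^^ (1 + 1 + 1)"
    by (rule relpow_trans[where y = "?s 6 6 ?B"], rule relpow_trans[where y = "?s 6 5 ?B"];
        rule step; simp)
  have "(?s 3 3 ?B, ?s 3 3 ?E) \<in> moves (Suc k) ^^ N"
    using BE by (rule moves_lift) auto
  moreover have "(?s 5 5 ?E, ?s 5 5 ?B) \<in> moves (Suc k) ^^ N"
    using moves_relpow_sym[OF BE] by (rule moves_lift) auto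
  ultimately have "(?s 1 1 ?B, ?s 7 6 ?B)
      \<in> moves (Suc k) ^^ ((1 + 1 + 1 + 1) + (N + ((1 + 1 + 1 + 1) + (N + (1 + 1 + 1)))))"
    using up1 up2 up3 by (blast intro: relpow_trans)
  also have "(1 + 1 + 1 + 1) + (N + ((1 + 1 + 1 + 1) + (N + (1 + 1 + 1)))) = 11 * (2 ^ Suc k - 1)"
  proof -
    \<comment> \<open>Removes the truncated subtraction on naturals, so that the identity becomes
      linear in \<open>M\<close>.\<close>
    obtain M where "2 ^ k = Suc M" using gr0_conv_Suc[of "2 ^ k"] by auto
    then show ?thesis by (simp add: N_def)
  qed
  finally show ?case by (simp del: moves_def)
qed auto

theorem theorem1:
  shows "\<exists>c1 c2 :: real. 0 < c1 \<and> 0 < c2 \<and>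
    (\<forall>k \<ge> 1. ereal (c1 * 2 ^ k) \<le> reconf_dist (with_proj (Gk k)) Src Tgt (p_b k) (p_e k) \<and>
             reconf_dist (with_proj (Gk k)) Src Tgt (p_b k) (p_e k) \<le> ereal (c2 * 2 ^ k))"
proof (rule exI[of _ "1 / 2"], rule exI[of _ 11], intro conjI allI impI)
  \<comment> \<open>The constant 1/2 turns \<open>2 ^ k\<close> into the lower bound
    \<open>2 ^ n\<close> for \<open>k = Suc n\<close>; 11 is the number of top-level steps per
    traversal.\<close>
  fix k :: nat
  assume "1 \<le> k"
  then obtain n where k: "k = Suc n" by (cases k) auto
  have p: "p_b k = Src # base_path (Suc n)" "p_e k = Src # end_path (Suc n)"
    by (simp_all add: k p_b_def p_e_def)
  show "ereal (1 / 2 * 2 ^ k) \<le> reconf_dist (with_proj (Gk k)) Src Tgt (p_b k) (p_e k)"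
  proof (rule reconf_dist_ge)
    fix m
    assume "(p_b k, p_e k) \<in> parcs (reconf_graph (with_proj (Gk k)) Src Tgt) ^^ m"
    then have "(base_path (Suc n), end_path (Suc n)) \<in> moves (Suc n) ^^ m"
      unfolding p unfolding k reconf_relpow_iff .
    from moves_relpow_ge[OF this] have "2 ^ n \<le> m"
      using hd_base_path hd_end_path by blast
    then have "real (2 ^ n) \<le> real m" by (rule of_nat_mono)
    then show "1 / 2 * 2 ^ k \<le> real m" by (simp add: k)
  qed
  have "reconf_dist (with_proj (Gk k)) Src Tgt (p_b k) (p_e k) \<le> ereal (real (11 * (2 ^ k - 1)))"
  proof (rule reconf_dist_le)
    show "(p_b k, p_e k)
        \<in> parcs (reconf_graph (with_proj (Gk k)) Src Tgt) ^^ (11 * (2 ^ k - 1))"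
      unfolding p unfolding k reconf_relpow_iff by (rule moves_base_end)
    show "shortest_vpath (with_proj (Gk k)) Src Tgt (p_e k)"
      unfolding p unfolding k shortest_vpath_Gk_iff using descent_end_path by blast
  qed
  also have "ereal (real (11 * (2 ^ k - 1))) \<le> ereal (11 * 2 ^ k)"
    by (simp add: of_nat_diff)
  finally show "reconf_dist (with_proj (Gk k)) Src Tgt (p_b k) (p_e k) \<le> ereal (11 * 2 ^ k)" .
qed simp_all

end
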